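(* Let $X$ and $Y$ be real Banach spaces with preduals $X_*$ and $Y_*$, where $X_*$ is separable or reflexive. Let $K\colon X\to Y$ be a bounded dilinear mapping, $R\colon X\to\overline{\mathbb R}$ a non-negative, proper, diconvex functional, $g^\delta\in Y$, $p\ge1$, and for $\alpha>0$ put $$J_\alpha(u):=\|K(u)-g^\delta\|^p+\alpha R(u)\qquad(u\in X).$$ Assume that (i) $J_\alpha(u)\to+\infty$ whenever $\|u\|\to+\infty$; (ii) $R$ is sequentially weakly$*$ lower semi-continuous; (iii) $K$ is sequentially weakly$*$ continuous. Then, for every $\alpha>0$, there exists at least one minimizer $u_\alpha^\delta\in X$ of $J_\alpha$.
   Context: $\overline{\mathbb R}=\mathbb R\cup\{\pm\infty\}$; a functional is proper if it is never $-\infty$ and not identically $+\infty$. For a real Banach space $X$, $X\otimes_\pi X$ is the (completed) projective tensor product and $X\otimes_{\pi,\mathrm{sym}}X$ is its closed subspace spanned by the tensors $u\otimes u$, $u\in X$. A mapping $K\colon X\to Y$ is dilinear if there is a linear $\breve K\colon X\times(X\otimes_{\pi,\mathrm{sym}}X)\to Y$ with $K(u)=\breve K(u,u\otimes u)$ for all $u\in X$; it is bounded if $\breve K$ is bounded. A mapping $F\colon X\to\overline{\mathbb R}$ is diconvex if there is a proper, convex $\breve F\colon X\times(X\otimes_{\pi,\mathrm{sym}}X)\to\overline{\mathbb R}$ with $F(u)=\breve F(u,u\otimes u)$ for all $u\in X$. Weak$*$ topologies on $X$ and $Y$ are those induced by the preduals $X_*$ and $Y_*$. Assumption (i) is understood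 for every $\alpha>0$. *)

theory Defs
  imports "HOL-Analysis.Analysis"
begin

section \<open>Algebraic tensor product\<close>

text \<open>
  A list \<open>[(x\<^sub>1, y\<^sub>1), \<dots>, (x\<^sub>n, y\<^sub>n)]\<close> stands for the finite sum of the \<open>x\<^sub>i \<otimes> y\<^sub>i\<close>; scalars are
  absorbed into the first factor.  Two such sums are the same tensor iff they cannot be
  told apart by any bilinear form, bounded or not.
\<close>

definition tensor_eval :: "('a \<Rightarrow> 'b \<Rightarrow> real) \<Rightarrow> ('a \<times> 'b) list \<Rightarrow> real"
  where "tensor_eval b w = (\<Sum>(x, y)\<leftarrow>w. b x y)"

definition tensor_eq :: "('a::real_vector \<times> 'b::real_vector) list \<Rightarrow> ('a \<times> 'b) list \<Rightarrow> bool"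
  where "tensor_eq v w \<longleftrightarrow> (\<forall>b. bilinear b \<longrightarrow> tensor_eval b v = tensor_eval b w)"

quotient_type (overloaded) ('a, 'b) tensor = "('a::real_vector \<times> 'b::real_vector) list" / tensor_eq
  by (rule equivpI) (auto intro: reflpI sympI transpI simp: tensor_eq_def)

lemma tensor_eval_simps [simp]:
  "tensor_eval b [] = 0"
  "tensor_eval b (v @ w) = tensor_eval b v + tensor_eval b w"
  "tensor_eval b ((x, y) # w) = b x y + tensor_eval b w"
  by (simp_all add: tensor_eval_def)

lemma tensor_eval_scale [simp]:
  assumes "bilinear b"
  shows "tensor_eval b (map (\<lambda>(x, y). (r *\<^sub>R x, y)) w) = r * tensor_eval b w"
  by (induction w) (auto simp: bilinear_lmul[OF assms] algebra_simps)

instantiation tensor :: (real_vector, real_vector) real_vector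
begin

lift_definition zero_tensor :: "('a, 'b) tensor" is "[]" .

lift_definition plus_tensor :: "('a, 'b) tensor \<Rightarrow> ('a, 'b) tensor \<Rightarrow> ('a, 'b) tensor" is "(@)"
  by (simp add: tensor_eq_def)

lift_definition scaleR_tensor :: "real \<Rightarrow> ('a, 'b) tensor \<Rightarrow> ('a, 'b) tensor"
  is "\<lambda>r. map (\<lambda>(x, y). (r *\<^sub>R x, y))"
  by (simp add: tensor_eq_def)

definition uminus_tensor :: "('a, 'b) tensor \<Rightarrow> ('a, 'b) tensor"
  where "uminus_tensor t = (-1) *\<^sub>R t"

definition minus_tensor :: "('a, 'b) tensor \<Rightarrow> ('a, 'b) tensor \<Rightarrow> ('a, 'b) tensor"
  where "minus_tensor s t = s + (-1) *\<^sub>R t"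

instance
proof
  fix a b c :: "('a, 'b) tensor" and r s :: real
  show "a + b + c = a + (b + c)" by transfer (simp add: tensor_eq_def)
  show "a + b = b + a" by transfer (simp add: tensor_eq_def)
  show "0 + a = a" by transfer (simp add: tensor_eq_def)
  show "- a + a = 0" unfolding uminus_tensor_def
  proof (transfer, unfold tensor_eq_def, intro allI impI)
    fix w :: "('a \<times> 'b) list" and b :: "'a \<Rightarrow> 'b \<Rightarrow> real"
    assume "bilinear b"
    from tensor_eval_scale[OF this, of "-1" w]
    show "tensor_eval b (map (\<lambda>(x, y). ((-1) *\<^sub>R x, y)) w @ w) = tensor_eval b []" by simp
  qed
  show "a - b = a + - b" by (simp add: minus_tensor_def uminus_tensor_def)
  show "r *\<^sub>R (a + b) = r *\<^sub>R a + r *\<^sub>R b"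
    by transfer (simp add: tensor_eq_def algebra_simps)
  show "(r + s) *\<^sub>R a = r *\<^sub>R a + s *\<^sub>R a"
    by transfer (simp add: tensor_eq_def distrib_right)
  show "r *\<^sub>R s *\<^sub>R a = (r * s) *\<^sub>R a"
    by transfer (simp add: tensor_eq_def algebra_simps del: map_map)
  show "1 *\<^sub>R a = a" by transfer (simp add: tensor_eq_def)
qed

end

lift_definition tensor :: "'a::real_vector \<Rightarrow> 'b::real_vector \<Rightarrow> ('a, 'b) tensor"
  is "\<lambda>x y. [(x, y)]" .


section \<open>Projective tensor product\<close>

definition rep_cost :: "('a::real_normed_vector \<times> 'b::real_normed_vector) list \<Rightarrow> real"
  where "rep_cost w = (\<Sum>(x, y)\<leftarrow>w. norm x * norm y)"

definition proj_norm :: "('a::real_normed_vector, 'b::real_normed_vector) tensor \<Rightarrow> real"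
  where "proj_norm t = Inf {rep_cost w | w. abs_tensor w = t}"

lemma rep_cost_nonneg: "0 \<le> rep_cost w"
  by (induction w) (auto simp: rep_cost_def)

lemma rep_cost_bdd: "bdd_below {rep_cost w | w. P w}"
  by (rule bdd_belowI[of _ 0]) (auto simp: rep_cost_nonneg)

lemma proj_norm_le: "proj_norm (abs_tensor w) \<le> rep_cost w"
  unfolding proj_norm_def by (rule cInf_lower) (auto simp: rep_cost_bdd)

lemma proj_norm_rep:
  assumes "0 < e"
  obtains w where "abs_tensor w = t" "rep_cost w < proj_norm t + e"
proof -
  obtain w0 where "abs_tensor w0 = t"
    by (metis Quotient_abs_rep[OF Quotient_tensor])
  then have ne: "{rep_cost w | w. abs_tensor w = t} \<noteq> {}" by auto
  have "Inf {rep_cost w | w. abs_tensor w = t} < proj_norm t + e"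
    using assms by (simp add: proj_norm_def)
  then show ?thesis
    using that cInf_lessD[OF ne] by auto
qed

lemma proj_norm_nonneg [simp]: "0 \<le> proj_norm t"
proof (rule field_le_epsilon)
  fix e :: real assume "0 < e"
  then obtain w where "abs_tensor w = t" "rep_cost w < proj_norm t + e"
    by (rule proj_norm_rep)
  then show "0 \<le> proj_norm t + e" using rep_cost_nonneg[of w] by simp
qed

lemma proj_norm_zero [simp]: "proj_norm (0 :: ('a::real_normed_vector, 'b::real_normed_vector) tensor) = 0"
  using proj_norm_le[of "[] :: ('a \<times> 'b) list"] proj_norm_nonneg[of "0 :: ('a, 'b) tensor"]
  by (simp add: rep_cost_def zero_tensor.abs_eq del: proj_norm_nonneg)

lemma proj_norm_triangle: "proj_norm (s + t) \<le> proj_norm s + proj_norm t"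
proof (rule field_le_epsilon)
  fix e :: real assume "0 < e"
  then have e: "0 < e / 2" by simp
  obtain v where v: "abs_tensor v = s" "rep_cost v < proj_norm s + e / 2"
    using proj_norm_rep[OF e] by blast
  obtain w where w: "abs_tensor w = t" "rep_cost w < proj_norm t + e / 2"
    using proj_norm_rep[OF e] by blast
  have "proj_norm (s + t) \<le> rep_cost (v @ w)"
    using proj_norm_le[of "v @ w"] v(1) w(1) by (metis plus_tensor.abs_eq)
  also have "\<dots> = rep_cost v + rep_cost w" by (simp add: rep_cost_def)
  finally show "proj_norm (s + t) \<le> proj_norm s + proj_norm t + e" using v w by simp
qed

lemma proj_norm_scaleR_le: "proj_norm (r *\<^sub>R t) \<le> \<bar>r\<bar> * proj_norm t"
proof (cases "r = 0")
  case False
  show ?thesis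
  proof (rule field_le_epsilon)
    fix e :: real assume "0 < e"
    then have "0 < e / \<bar>r\<bar>" using False by simp
    then obtain w where w: "abs_tensor w = t" "rep_cost w < proj_norm t + e / \<bar>r\<bar>"
      by (rule proj_norm_rep)
    have "rep_cost (map (\<lambda>(x, y). (r *\<^sub>R x, y)) w) = \<bar>r\<bar> * rep_cost w" for w :: "('a \<times> 'b) list"
      by (induction w) (auto simp: rep_cost_def algebra_simps)
    then have "proj_norm (r *\<^sub>R t) \<le> \<bar>r\<bar> * rep_cost w"
      using proj_norm_le[of "map (\<lambda>(x, y). (r *\<^sub>R x, y)) w"] w(1) by (metis scaleR_tensor.abs_eq)
    also have "\<dots> \<le> \<bar>r\<bar> * (proj_norm t + e / \<bar>r\<bar>)" using w by (intro mult_left_mono) auto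
    also have "\<dots> = \<bar>r\<bar> * proj_norm t + e" using False by (simp add: algebra_simps)
    finally show "proj_norm (r *\<^sub>R t) \<le> \<bar>r\<bar> * proj_norm t + e" .
  qed
qed simp

lemma proj_norm_scaleR [simp]: "proj_norm (r *\<^sub>R t) = \<bar>r\<bar> * proj_norm t"
proof (cases "r = 0")
  case False
  have "proj_norm t \<le> \<bar>inverse r\<bar> * proj_norm (r *\<^sub>R t)"
    using proj_norm_scaleR_le[of "inverse r" "r *\<^sub>R t"] False by simp
  then have "\<bar>r\<bar> * proj_norm t \<le> proj_norm (r *\<^sub>R t)"
    using False by (simp add: field_simps)
  then show ?thesis using proj_norm_scaleR_le[of r t] by simp
qed simp

lemma proj_norm_minus [simp]: "proj_norm (- t) = proj_norm t"
  using proj_norm_scaleR[of "-1" t] by simp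

lemma proj_norm_commute: "proj_norm (s - t) = proj_norm (t - s)"
  by (metis minus_diff_eq proj_norm_minus)

lemma proj_norm_triangle_sub: "proj_norm (s - t) \<le> proj_norm (s - u) + proj_norm (u - t)"
  using proj_norm_triangle[of "s - u" "u - t"] by simp

lemma proj_norm_reverse: "\<bar>proj_norm s - proj_norm t\<bar> \<le> proj_norm (s - t)"
  using proj_norm_triangle[of "s - t" t] proj_norm_triangle[of "t - s" s]
    proj_norm_commute[of s t] by simp

definition pcauchy :: "(nat \<Rightarrow> ('a::real_normed_vector, 'b::real_normed_vector) tensor) \<Rightarrow> bool"
  where "pcauchy S \<longleftrightarrow> (\<forall>e>0. \<exists>N. \<forall>m\<ge>N. \<forall>n\<ge>N. proj_norm (S m - S n) < e)"

definition pequiv ::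
    "(nat \<Rightarrow> ('a::real_normed_vector, 'b::real_normed_vector) tensor) \<Rightarrow> (nat \<Rightarrow> ('a, 'b) tensor) \<Rightarrow> bool"
  where "pequiv S T \<longleftrightarrow> pcauchy S \<and> pcauchy T \<and> (\<lambda>n. proj_norm (S n - T n)) \<longlonglongrightarrow> 0"

lemma pcauchy_const [simp]: "pcauchy (\<lambda>_. t)"
  by (simp add: pcauchy_def)

lemma proj_null_le:
  assumes "f \<longlonglongrightarrow> 0" "\<And>n. proj_norm (D n) \<le> f n"
  shows "(\<lambda>n. proj_norm (D n)) \<longlonglongrightarrow> 0"
  by (rule tendsto_sandwich[OF _ _ tendsto_const assms(1)]) (auto simp: assms(2))

lemma pequiv_refl: "pcauchy S \<Longrightarrow> pequiv S S"
  by (simp add: pequiv_def)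

lemma part_equivp_pequiv:
  "part_equivp (pequiv :: (nat \<Rightarrow> ('a::real_normed_vector, 'b::real_normed_vector) tensor) \<Rightarrow> _)"
proof (rule part_equivpI)
  show "\<exists>S :: nat \<Rightarrow> ('a, 'b) tensor. pequiv S S"
    using pequiv_refl[OF pcauchy_const] by blast
  show "symp (pequiv :: (nat \<Rightarrow> ('a, 'b) tensor) \<Rightarrow> _)"
    by (rule sympI) (auto simp: pequiv_def proj_norm_commute)
  show "transp (pequiv :: (nat \<Rightarrow> ('a, 'b) tensor) \<Rightarrow> _)"
  proof (rule transpI)
    fix S T U :: "nat \<Rightarrow> ('a, 'b) tensor"
    assume *: "pequiv S T" "pequiv T U"
    have "(\<lambda>n. proj_norm (S n - T n) + proj_norm (T n - U n)) \<longlonglongrightarrow> 0"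
      using * tendsto_add[of _ 0 sequentially _ 0] by (auto simp: pequiv_def)
    then have "(\<lambda>n. proj_norm (S n - U n)) \<longlonglongrightarrow> 0"
      by (rule proj_null_le) (rule proj_norm_triangle_sub)
    then show "pequiv S U" using * by (simp add: pequiv_def)
  qed
qed

text \<open>The completion of the algebraic tensor product with respect to \<^const>\<open>proj_norm\<close>.\<close>

quotient_type (overloaded) ('a, 'b) ptensor =
    "nat \<Rightarrow> ('a::real_normed_vector, 'b::real_normed_vector) tensor" / partial: pequiv
  by (rule part_equivp_pequiv)

lemma pcauchy_add:
  assumes "pcauchy S" "pcauchy T"
  shows "pcauchy (\<lambda>n. S n + T n)"
  unfolding pcauchy_def
proof (intro allI impI)
  fix e :: real assume "0 < e"
  then have e: "0 < e / 2" by simp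
  obtain M where M: "\<And>m n. m \<ge> M \<Longrightarrow> n \<ge> M \<Longrightarrow> proj_norm (S m - S n) < e / 2"
    using assms(1) e unfolding pcauchy_def by blast
  obtain N where N: "\<And>m n. m \<ge> N \<Longrightarrow> n \<ge> N \<Longrightarrow> proj_norm (T m - T n) < e / 2"
    using assms(2) e unfolding pcauchy_def by blast
  have "proj_norm (S m + T m - (S n + T n)) < e" if "m \<ge> max M N" "n \<ge> max M N" for m n
    using M[of m n] N[of m n] that proj_norm_triangle[of "S m - S n" "T m - T n"]
    by (simp add: algebra_simps)
  then show "\<exists>N. \<forall>m\<ge>N. \<forall>n\<ge>N. proj_norm (S m + T m - (S n + T n)) < e" by blast
qed

lemma pcauchy_scaleR:
  assumes "pcauchy S"
  shows "pcauchy (\<lambda>n. r *\<^sub>R S n)"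
  unfolding pcauchy_def
proof (intro allI impI)
  fix e :: real assume "0 < e"
  then have "0 < e / (\<bar>r\<bar> + 1)" by (simp add: add_nonneg_pos)
  then obtain N where N: "\<And>m n. m \<ge> N \<Longrightarrow> n \<ge> N \<Longrightarrow> proj_norm (S m - S n) < e / (\<bar>r\<bar> + 1)"
    using assms unfolding pcauchy_def by blast
  have "proj_norm (r *\<^sub>R S m - r *\<^sub>R S n) < e" if "m \<ge> N" "n \<ge> N" for m n
  proof -
    have "proj_norm (r *\<^sub>R S m - r *\<^sub>R S n) = \<bar>r\<bar> * proj_norm (S m - S n)"
      by (metis proj_norm_scaleR scaleR_diff_right)
    also have "\<dots> \<le> (\<bar>r\<bar> + 1) * proj_norm (S m - S n)"
      by (rule mult_right_mono) auto
    also have "\<dots> < e" using N[OF that] by (simp add: field_simps)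
    finally show ?thesis .
  qed
  then show "\<exists>N. \<forall>m\<ge>N. \<forall>n\<ge>N. proj_norm (r *\<^sub>R S m - r *\<^sub>R S n) < e" by blast
qed

lemma pcauchy_convergent:
  assumes "pcauchy S"
  shows "convergent (\<lambda>n. proj_norm (S n))"
proof -
  have "Cauchy (\<lambda>n. proj_norm (S n))"
  proof (rule metric_CauchyI)
    fix e :: real assume "0 < e"
    then obtain N where N: "\<And>m n. m \<ge> N \<Longrightarrow> n \<ge> N \<Longrightarrow> proj_norm (S m - S n) < e"
      using assms unfolding pcauchy_def by blast
    have "dist (proj_norm (S m)) (proj_norm (S n)) < e" if "m \<ge> N" "n \<ge> N" for m n
      using N[OF that] proj_norm_reverse[of "S m" "S n"] by (simp add: dist_real_def)
    then show "\<exists>M. \<forall>m\<ge>M. \<forall>n\<ge>M. dist (proj_norm (S m)) (proj_norm (S n)) < e" by blast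
  qed
  then show ?thesis by (rule Cauchy_convergent)
qed

instantiation ptensor :: (real_normed_vector, real_normed_vector) real_normed_vector
begin

lift_definition zero_ptensor :: "('a, 'b) ptensor" is "\<lambda>_. 0"
  by (simp add: pequiv_refl)

lift_definition plus_ptensor :: "('a, 'b) ptensor \<Rightarrow> ('a, 'b) ptensor \<Rightarrow> ('a, 'b) ptensor"
  is "\<lambda>S T n. S n + T n"
proof -
  fix S S' T T' :: "nat \<Rightarrow> ('a, 'b) tensor"
  assume *: "pequiv S S'" "pequiv T T'"
  have "(\<lambda>n. proj_norm (S n - S' n) + proj_norm (T n - T' n)) \<longlonglongrightarrow> 0"
    using * tendsto_add[of _ 0 sequentially _ 0] by (auto simp: pequiv_def)
  then have "(\<lambda>n. proj_norm (S n + T n - (S' n + T' n))) \<longlonglongrightarrow> 0"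
    by (rule proj_null_le) (metis add_diff_add proj_norm_triangle)
  then show "pequiv (\<lambda>n. S n + T n) (\<lambda>n. S' n + T' n)"
    using * by (simp add: pequiv_def pcauchy_add)
qed

lift_definition scaleR_ptensor :: "real \<Rightarrow> ('a, 'b) ptensor \<Rightarrow> ('a, 'b) ptensor"
  is "\<lambda>r S n. r *\<^sub>R S n"
proof -
  fix r and S T :: "nat \<Rightarrow> ('a, 'b) tensor"
  assume *: "pequiv S T"
  have "(\<lambda>n. \<bar>r\<bar> * proj_norm (S n - T n)) \<longlonglongrightarrow> 0"
    using * tendsto_mult_left[of _ 0] by (force simp: pequiv_def)
  then have "(\<lambda>n. proj_norm (r *\<^sub>R S n - r *\<^sub>R T n)) \<longlonglongrightarrow> 0"
    by (simp flip: scaleR_diff_right)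
  then show "pequiv (\<lambda>n. r *\<^sub>R S n) (\<lambda>n. r *\<^sub>R T n)"
    using * by (simp add: pequiv_def pcauchy_scaleR)
qed

lift_definition norm_ptensor :: "('a, 'b) ptensor \<Rightarrow> real"
  is "\<lambda>S. lim (\<lambda>n. proj_norm (S n))"
proof -
  fix S T :: "nat \<Rightarrow> ('a, 'b) tensor"
  assume *: "pequiv S T"
  have "(\<lambda>n. proj_norm (S n)) \<longlonglongrightarrow> lim (\<lambda>n. proj_norm (S n))"
    using * by (simp add: pequiv_def pcauchy_convergent convergent_LIMSEQ_iff[symmetric])
  moreover have "(\<lambda>n. proj_norm (T n) - proj_norm (S n)) \<longlonglongrightarrow> 0"
    by (rule Lim_null_comparison[of _ "\<lambda>n. proj_norm (S n - T n)"])
       (use * proj_norm_reverse in \<open>auto simp: pequiv_def abs_minus_commute intro!: always_eventually\<close>)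
  ultimately have "(\<lambda>n. proj_norm (T n)) \<longlonglongrightarrow> lim (\<lambda>n. proj_norm (S n))"
    using tendsto_add by fastforce
  then show "lim (\<lambda>n. proj_norm (S n)) = lim (\<lambda>n. proj_norm (T n))"
    by (simp add: limI)
qed

definition uminus_ptensor :: "('a, 'b) ptensor \<Rightarrow> ('a, 'b) ptensor"
  where "uminus_ptensor t = (-1) *\<^sub>R t"

definition minus_ptensor :: "('a, 'b) ptensor \<Rightarrow> ('a, 'b) ptensor \<Rightarrow> ('a, 'b) ptensor"
  where "minus_ptensor s t = s + (-1) *\<^sub>R t"

definition sgn_ptensor :: "('a, 'b) ptensor \<Rightarrow> ('a, 'b) ptensor"
  where "sgn_ptensor t = inverse (norm t) *\<^sub>R t"

definition dist_ptensor :: "('a, 'b) ptensor \<Rightarrow> ('a, 'b) ptensor \<Rightarrow> real"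
  where "dist_ptensor s t = norm (s - t)"

definition uniformity_ptensor :: "(('a, 'b) ptensor \<times> ('a, 'b) ptensor) filter"
  where "uniformity_ptensor = (INF e\<in>{0<..}. principal {(x, y). dist x y < e})"

definition open_ptensor :: "('a, 'b) ptensor set \<Rightarrow> bool"
  where "open_ptensor U = (\<forall>x\<in>U. eventually (\<lambda>(x', y). x' = x \<longrightarrow> y \<in> U) uniformity)"

instance
proof
  fix a b c :: "('a, 'b) ptensor" and r s :: real and U :: "('a, 'b) ptensor set"
  have lims: "(\<lambda>n. proj_norm (S n)) \<longlonglongrightarrow> lim (\<lambda>n. proj_norm (S n))"
    if "pequiv S S" for S :: "nat \<Rightarrow> ('a, 'b) tensor"
    using that by (simp add: pequiv_def pcauchy_convergent convergent_LIMSEQ_iff[symmetric])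
  show "a + b + c = a + (b + c)"
    by transfer (simp add: pequiv_def pcauchy_add add.assoc)
  show "a + b = b + a"
    by transfer (simp add: pequiv_def pcauchy_add add.commute)
  show "0 + a = a" by transfer simp
  show "- a + a = 0" unfolding uminus_ptensor_def by transfer (simp add: pequiv_refl)
  show "a - b = a + - b" by (simp add: minus_ptensor_def uminus_ptensor_def)
  show "r *\<^sub>R (a + b) = r *\<^sub>R a + r *\<^sub>R b"
    by transfer (simp add: pequiv_def pcauchy_add pcauchy_scaleR scaleR_right_distrib)
  show "(r + s) *\<^sub>R a = r *\<^sub>R a + s *\<^sub>R a"
    by transfer (simp add: pequiv_def pcauchy_add pcauchy_scaleR scaleR_left_distrib)
  show "r *\<^sub>R s *\<^sub>R a = (r * s) *\<^sub>R a"
    by transfer (simp add: pequiv_def pcauchy_scaleR)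
  show "1 *\<^sub>R a = a" by transfer simp
  show "sgn a = inverse (norm a) *\<^sub>R a" by (rule sgn_ptensor_def)
  show "dist a b = norm (a - b)" by (rule dist_ptensor_def)
  show "uniformity = (INF e\<in>{0<..}. principal {(x, y :: ('a, 'b) ptensor). dist x y < e})"
    by (rule uniformity_ptensor_def)
  show "open U = (\<forall>x\<in>U. \<forall>\<^sub>F (x', y) in uniformity. x' = x \<longrightarrow> y \<in> U)"
    by (rule open_ptensor_def)
  show "norm a = 0 \<longleftrightarrow> a = 0"
  proof (transfer, goal_cases)
    case (1 S)
    have "lim (\<lambda>n. proj_norm (S n)) = 0 \<longleftrightarrow> (\<lambda>n. proj_norm (S n)) \<longlonglongrightarrow> 0"
      using lims[OF 1] limI by metis
    then show ?case using 1 by (simp add: pequiv_def)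
  qed
  show "norm (a + b) \<le> norm a + norm b"
  proof (transfer, goal_cases)
    case (1 S T)
    then have "pequiv (\<lambda>n. S n + T n) (\<lambda>n. S n + T n)"
      by (simp add: pequiv_def pcauchy_add)
    then show ?case
      by (rule LIMSEQ_le[OF lims tendsto_add[OF lims[OF 1(1)] lims[OF 1(2)]]])
         (auto simp: proj_norm_triangle)
  qed
  show "norm (r *\<^sub>R a) = \<bar>r\<bar> * norm a"
  proof (transfer, goal_cases)
    case (1 r S)
    show ?case using tendsto_mult_left[OF lims[OF 1], of "\<bar>r\<bar>"] by (simp add: limI)
  qed
qed

end

definition of_tensor ::
    "('a::real_normed_vector, 'b::real_normed_vector) tensor \<Rightarrow> ('a, 'b) ptensor"
  where "of_tensor t = abs_ptensor (\<lambda>_. t)"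

lemma norm_of_tensor: "norm (of_tensor t) = proj_norm t"
  by (simp add: of_tensor_def norm_ptensor.abs_eq pequiv_refl limI)

lemma linear_of_tensor: "linear of_tensor"
  by (rule linearI)
     (simp_all add: of_tensor_def plus_ptensor.abs_eq scaleR_ptensor.abs_eq pequiv_refl)

lemma of_tensor_diff: "of_tensor (s - t) = of_tensor s - of_tensor t"
  by (rule linear_diff[OF linear_of_tensor])

lemma abs_ptensor_limit:
  assumes "pcauchy S"
  shows "(\<lambda>n. of_tensor (S n)) \<longlonglongrightarrow> abs_ptensor S"
proof (rule metric_LIMSEQ_I)
  fix e :: real assume "0 < e"
  then have "0 < e / 2" by simp
  then obtain N where N: "\<And>m n. m \<ge> N \<Longrightarrow> n \<ge> N \<Longrightarrow> proj_norm (S m - S n) < e / 2"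
    using assms unfolding pcauchy_def by blast
  have "dist (of_tensor (S m)) (abs_ptensor S) < e" if m: "m \<ge> N" for m
  proof -
    have S: "pequiv S S" and Sm: "pequiv (\<lambda>_. S m) (\<lambda>_. S m)"
      using assms by (auto simp: pequiv_refl)
    have S': "pequiv (\<lambda>n. (-1) *\<^sub>R S n) (\<lambda>n. (-1) *\<^sub>R S n)"
      by (rule pequiv_refl[OF pcauchy_scaleR[OF assms]])
    have D: "pcauchy (\<lambda>n. S m + (-1) *\<^sub>R S n)"
      by (rule pcauchy_add[OF pcauchy_const pcauchy_scaleR[OF assms]])
    have "of_tensor (S m) - abs_ptensor S = abs_ptensor (\<lambda>n. S m + (-1) *\<^sub>R S n)"
      unfolding minus_ptensor_def of_tensor_def
      by (simp only: scaleR_ptensor.abs_eq[OF S] plus_ptensor.abs_eq[OF Sm S'])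
    then have "dist (of_tensor (S m)) (abs_ptensor S) = lim (\<lambda>n. proj_norm (S m - S n))"
      using norm_ptensor.abs_eq[OF pequiv_refl[OF D]] by (simp add: dist_norm)
    also have "\<dots> \<le> e / 2"
    proof (rule LIMSEQ_le_const2)
      show "(\<lambda>n. proj_norm (S m - S n)) \<longlonglongrightarrow> lim (\<lambda>n. proj_norm (S m - S n))"
        using pcauchy_convergent[OF D] by (simp add: convergent_LIMSEQ_iff)
      show "\<exists>N. \<forall>n\<ge>N. proj_norm (S m - S n) \<le> e / 2"
        using N[OF m] by (meson less_imp_le)
    qed
    also have "\<dots> < e" using \<open>0 < e\<close> by simp
    finally show ?thesis .
  qed
  then show "\<exists>N. \<forall>m\<ge>N. dist (of_tensor (S m)) (abs_ptensor S) < e" by blast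
qed

lemma ptensor_limit:
  obtains S where "pcauchy S" "(\<lambda>n. of_tensor (S n)) \<longlonglongrightarrow> t"
proof -
  have "pcauchy (rep_ptensor t)" "abs_ptensor (rep_ptensor t) = t"
    using Quotient_rep_reflp[OF Quotient_ptensor, of t] Quotient_abs_rep[OF Quotient_ptensor, of t]
    by (auto simp: pequiv_def)
  then show ?thesis
    using that[of "rep_ptensor t"] abs_ptensor_limit[of "rep_ptensor t"] by simp
qed

lemma closure_range_of_tensor:
  "closure (range of_tensor) = (UNIV :: ('a::real_normed_vector, 'b::real_normed_vector) ptensor set)"
proof (intro equalityI subset_UNIV subsetI)
  fix t :: "('a, 'b) ptensor"
  obtain S where "(\<lambda>n. of_tensor (S n)) \<longlonglongrightarrow> t" by (rule ptensor_limit)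
  then show "t \<in> closure (range of_tensor)"
    unfolding closure_sequential by (intro exI[of _ "\<lambda>n. of_tensor (S n)"]) simp
qed

instance ptensor :: (real_normed_vector, real_normed_vector) banach
proof
  fix X :: "nat \<Rightarrow> ('a, 'b) ptensor"
  assume X: "Cauchy X"
  have "\<exists>t. dist (of_tensor t) (X n) < inverse (Suc n)" for n
  proof -
    have "X n \<in> closure (range of_tensor)" by (simp add: closure_range_of_tensor)
    then show ?thesis unfolding closure_approachable
      by (drule_tac spec[of _ "inverse (real (Suc n))"]) auto
  qed
  then obtain S where S: "\<And>n. dist (of_tensor (S n)) (X n) < inverse (Suc n)" by metis
  have lim0: "(\<lambda>n. dist (of_tensor (S n)) (X n)) \<longlonglongrightarrow> 0"
    by (rule tendsto_sandwich[OF _ _ tendsto_const LIMSEQ_inverse_real_of_nat])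
       (use S in \<open>auto intro!: always_eventually less_imp_le\<close>)
  have "pcauchy S"
    unfolding pcauchy_def
  proof (intro allI impI)
    fix e :: real assume "0 < e"
    then have e: "0 < e / 3" by simp
    obtain M where M: "\<And>m n. m \<ge> M \<Longrightarrow> n \<ge> M \<Longrightarrow> dist (X m) (X n) < e / 3"
      using metric_CauchyD[OF X e] by blast
    obtain N where N: "\<And>n. n \<ge> N \<Longrightarrow> dist (of_tensor (S n)) (X n) < e / 3"
      using metric_LIMSEQ_D[OF lim0 e] by (auto simp: dist_real_def)
    have "proj_norm (S m - S n) < e" if mn: "m \<ge> max M N" "n \<ge> max M N" for m n
    proof -
      have "proj_norm (S m - S n) = dist (of_tensor (S m)) (of_tensor (S n))"
        by (metis dist_norm norm_of_tensor of_tensor_diff)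
      also have "\<dots> \<le> dist (of_tensor (S m)) (X m) + dist (X m) (X n) + dist (X n) (of_tensor (S n))"
        using dist_triangle[of "of_tensor (S m)" "of_tensor (S n)" "X m"]
          dist_triangle[of "X m" "of_tensor (S n)" "X n"] by linarith
      also have "\<dots> < e"
        using M[of m n] N[of m] N[of n] mn by (simp add: dist_commute)
      finally show ?thesis .
    qed
    then show "\<exists>N. \<forall>m\<ge>N. \<forall>n\<ge>N. proj_norm (S m - S n) < e" by blast
  qed
  then have "(\<lambda>n. of_tensor (S n)) \<longlonglongrightarrow> abs_ptensor S" by (rule abs_ptensor_limit)
  moreover have "(\<lambda>n. X n - of_tensor (S n)) \<longlonglongrightarrow> 0"
    by (rule tendsto_norm_zero_cancel) (use lim0 in \<open>simp add: dist_norm norm_minus_commute\<close>)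
  ultimately have "X \<longlonglongrightarrow> abs_ptensor S" by (rule Lim_transform)
  then show "convergent X" by (rule convergentI)
qed

definition ptensor_prod :: "'a::real_normed_vector \<Rightarrow> 'b::real_normed_vector \<Rightarrow> ('a, 'b) ptensor"
  where "ptensor_prod x y = of_tensor (tensor x y)"


section \<open>Symmetric projective tensor product\<close>

definition symmetric_ptensors :: "('a::real_normed_vector, 'a) ptensor set"
  where "symmetric_ptensors = closure (span (range (\<lambda>u. ptensor_prod u u)))"

lemma subspace_closure:
  fixes S :: "'a::real_normed_vector set"
  assumes "subspace S"
  shows "subspace (closure S)"
proof (rule subspaceI)
  show "0 \<in> closure S"
    using subspace_0[OF assms] closure_subset by blast
next
  fix x y assume "x \<in> closure S" "y \<in> closure S"
  then obtain f g where "\<And>n. f n \<in> S" "f \<longlonglongrightarrow> x" "\<And>n. g n \<in> S" "g \<longlonglongrightarrow> y"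
    by (auto simp: closure_sequential)
  then have "\<And>n. f n + g n \<in> S" "(\<lambda>n. f n + g n) \<longlonglongrightarrow> x + y"
    by (simp_all add: subspace_add[OF assms] tendsto_add)
  then show "x + y \<in> closure S"
    unfolding closure_sequential by (intro exI[of _ "\<lambda>n. f n + g n"]) simp
next
  fix c x assume "x \<in> closure S"
  then obtain f where "\<And>n. f n \<in> S" "f \<longlonglongrightarrow> x"
    by (auto simp: closure_sequential)
  then have "\<And>n. c *\<^sub>R f n \<in> S" "(\<lambda>n. c *\<^sub>R f n) \<longlonglongrightarrow> c *\<^sub>R x"
    by (simp_all add: subspace_scale[OF assms] tendsto_scaleR)
  then show "c *\<^sub>R x \<in> closure S"
    unfolding closure_sequential by (intro exI[of _ "\<lambda>n. c *\<^sub>R f n"]) simp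
qed

lemma subspace_symmetric_ptensors: "subspace symmetric_ptensors"
  unfolding symmetric_ptensors_def by (intro subspace_closure subspace_span)

typedef (overloaded) 'a sym_ptensor = "symmetric_ptensors :: ('a::real_normed_vector, 'a) ptensor set"
  by (rule exI[of _ 0]) (rule subspace_0[OF subspace_symmetric_ptensors])

setup_lifting type_definition_sym_ptensor

instantiation sym_ptensor :: (real_normed_vector) real_normed_vector
begin

lift_definition zero_sym_ptensor :: "'a sym_ptensor" is 0
  by (rule subspace_0[OF subspace_symmetric_ptensors])

lift_definition plus_sym_ptensor :: "'a sym_ptensor \<Rightarrow> 'a sym_ptensor \<Rightarrow> 'a sym_ptensor" is "(+)"
  by (rule subspace_add[OF subspace_symmetric_ptensors])

lift_definition minus_sym_ptensor :: "'a sym_ptensor \<Rightarrow> 'a sym_ptensor \<Rightarrow> 'a sym_ptensor" is "(-)"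
  by (rule subspace_diff[OF subspace_symmetric_ptensors])

lift_definition uminus_sym_ptensor :: "'a sym_ptensor \<Rightarrow> 'a sym_ptensor" is uminus
  by (rule subspace_neg[OF subspace_symmetric_ptensors])

lift_definition scaleR_sym_ptensor :: "real \<Rightarrow> 'a sym_ptensor \<Rightarrow> 'a sym_ptensor" is scaleR
  by (rule subspace_scale[OF subspace_symmetric_ptensors])

lift_definition norm_sym_ptensor :: "'a sym_ptensor \<Rightarrow> real" is norm .

definition sgn_sym_ptensor :: "'a sym_ptensor \<Rightarrow> 'a sym_ptensor"
  where "sgn_sym_ptensor t = inverse (norm t) *\<^sub>R t"

definition dist_sym_ptensor :: "'a sym_ptensor \<Rightarrow> 'a sym_ptensor \<Rightarrow> real"
  where "dist_sym_ptensor s t = norm (s - t)"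

definition uniformity_sym_ptensor :: "('a sym_ptensor \<times> 'a sym_ptensor) filter"
  where "uniformity_sym_ptensor = (INF e\<in>{0<..}. principal {(x, y). dist x y < e})"

definition open_sym_ptensor :: "'a sym_ptensor set \<Rightarrow> bool"
  where "open_sym_ptensor U = (\<forall>x\<in>U. eventually (\<lambda>(x', y). x' = x \<longrightarrow> y \<in> U) uniformity)"

instance
proof
  fix a b c :: "'a sym_ptensor" and r s :: real and U :: "'a sym_ptensor set"
  note [simp] = Rep_sym_ptensor_inject[symmetric] zero_sym_ptensor.rep_eq plus_sym_ptensor.rep_eq
    minus_sym_ptensor.rep_eq uminus_sym_ptensor.rep_eq scaleR_sym_ptensor.rep_eq norm_sym_ptensor.rep_eq
  show "a + b + c = a + (b + c)" by simp
  show "a + b = b + a" by simp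
  show "0 + a = a" by simp
  show "- a + a = 0" by simp
  show "a - b = a + - b" by simp
  show "r *\<^sub>R (a + b) = r *\<^sub>R a + r *\<^sub>R b" by (simp add: algebra_simps)
  show "(r + s) *\<^sub>R a = r *\<^sub>R a + s *\<^sub>R a" by (simp add: algebra_simps)
  show "r *\<^sub>R s *\<^sub>R a = (r * s) *\<^sub>R a" by simp
  show "1 *\<^sub>R a = a" by simp
  show "sgn a = inverse (norm a) *\<^sub>R a" by (rule sgn_sym_ptensor_def)
  show "dist a b = norm (a - b)" by (rule dist_sym_ptensor_def)
  show "uniformity = (INF e\<in>{0<..}. principal {(x, y :: 'a sym_ptensor). dist x y < e})"
    by (rule uniformity_sym_ptensor_def)
  show "open U = (\<forall>x\<in>U. \<forall>\<^sub>F (x', y) in uniformity. x' = x \<longrightarrow> y \<in> U)"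
    by (rule open_sym_ptensor_def)
  show "norm a = 0 \<longleftrightarrow> a = 0" by simp
  show "norm (a + b) \<le> norm a + norm b" by (simp add: norm_triangle_ineq)
  show "norm (r *\<^sub>R a) = \<bar>r\<bar> * norm a" by simp
qed

end

lift_definition tensor_square :: "'a::real_normed_vector \<Rightarrow> 'a sym_ptensor"
  is "\<lambda>u. ptensor_prod u u"
  unfolding symmetric_ptensors_def by (meson closure_subset rangeI span_base subsetD)


section \<open>Dilinear mappings and diconvex functionals\<close>

text \<open>
  The product space carries the Euclidean combination of the two norms; boundedness of a linear
  map does not depend on which of the usual product norms is chosen.
\<close>

definition dilinear :: "('x::real_normed_vector \<Rightarrow> 'y::real_vector) \<Rightarrow> bool"
  where "dilinear K \<longleftrightarrow>
    (\<exists>L :: 'x \<times> 'x sym_ptensor \<Rightarrow> 'y. linear L \<and> (\<forall>u. K u = L (u, tensor_square u)))"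

definition bounded_dilinear :: "('x::real_normed_vector \<Rightarrow> 'y::real_normed_vector) \<Rightarrow> bool"
  where "bounded_dilinear K \<longleftrightarrow>
    (\<exists>L :: 'x \<times> 'x sym_ptensor \<Rightarrow> 'y. bounded_linear L \<and> (\<forall>u. K u = L (u, tensor_square u)))"

lemma bounded_dilinear_imp_dilinear: "bounded_dilinear K \<Longrightarrow> dilinear K"
  unfolding bounded_dilinear_def dilinear_def using bounded_linear.linear by blast

definition proper :: "('a \<Rightarrow> ereal) \<Rightarrow> bool"
  where "proper F \<longleftrightarrow> (\<forall>x. F x \<noteq> -\<infinity>) \<and> (\<exists>x. F x \<noteq> \<infinity>)"

definition convex_functional :: "('a::real_vector \<Rightarrow> ereal) \<Rightarrow> bool"
  where "convex_functional F \<longleftrightarrow>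
    (\<forall>x y t. 0 < t \<and> t < 1 \<longrightarrow>
      F ((1 - t) *\<^sub>R x + t *\<^sub>R y) \<le> ereal (1 - t) * F x + ereal t * F y)"

definition diconvex :: "('x::real_normed_vector \<Rightarrow> ereal) \<Rightarrow> bool"
  where "diconvex R \<longleftrightarrow>
    (\<exists>F :: 'x \<times> 'x sym_ptensor \<Rightarrow> ereal.
      proper F \<and> convex_functional F \<and> (\<forall>u. R u = F (u, tensor_square u)))"


section \<open>Preduals and weak* topologies\<close>

text \<open>
  A predual of \<open>X\<close> is a Banach space \<open>P\<close> together with an isometric isomorphism \<open>\<phi>\<close> of \<open>X\<close>
  onto the dual of \<open>P\<close>; the weak* topology on \<open>X\<close> depends on \<open>\<phi>\<close>.
\<close>

definition predual :: "('x::banach \<Rightarrow> ('p::banach \<Rightarrow>\<^sub>L real)) \<Rightarrow> bool"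
  where "predual \<phi> \<longleftrightarrow> linear \<phi> \<and> (\<forall>u. norm (\<phi> u) = norm u) \<and> surj \<phi>"

text \<open>For scalar-valued operators, the strong operator topology is pointwise convergence of
  functionals, i.e. the weak* topology of the dual of \<open>P\<close>.\<close>

definition weak_star_topology :: "('x \<Rightarrow> ('p::real_normed_vector \<Rightarrow>\<^sub>L real)) \<Rightarrow> 'x topology"
  where "weak_star_topology \<phi> = pullback_topology UNIV \<phi> strong_operator_topology"

lemma limitin_pullback_UNIV:
  "limitin (pullback_topology UNIV h T) u l F \<longleftrightarrow> limitin T (\<lambda>n. h (u n)) (h l) F"
  by (auto simp: limitin_def openin_pullback_topology topspace_pullback_topology)

lemma limitin_weak_star:
  "limitin (weak_star_topology \<phi>) u l F \<longleftrightarrow> (\<forall>f. ((\<lambda>n. \<phi> (u n) f) \<longlongrightarrow> \<phi> l f) F)"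
  by (simp add: weak_star_topology_def strong_operator_topology_def limitin_pullback_UNIV
      euclidean_product_topology[symmetric] limitin_componentwise del: limitin_canonical_iff)
     simp

definition seq_lsc :: "'x topology \<Rightarrow> ('x \<Rightarrow> ereal) \<Rightarrow> bool"
  where "seq_lsc T F \<longleftrightarrow>
    (\<forall>u l. limitin T u l sequentially \<longrightarrow> F l \<le> liminf (\<lambda>n. F (u n)))"

definition seq_continuous :: "'x topology \<Rightarrow> 'y topology \<Rightarrow> ('x \<Rightarrow> 'y) \<Rightarrow> bool"
  where "seq_continuous T S K \<longleftrightarrow>
    (\<forall>u l. limitin T u l sequentially \<longrightarrow> limitin S (\<lambda>n. K (u n)) (K l) sequentially)"

definition reflexive :: "'p::real_normed_vector itself \<Rightarrow> bool"
  where "reflexive _ \<longleftrightarrow>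
    (\<forall>\<psi> :: ('p \<Rightarrow>\<^sub>L real) \<Rightarrow>\<^sub>L real. \<exists>x :: 'p. \<forall>f. blinfun_apply \<psi> f = blinfun_apply f x)"


section \<open>Tikhonov functional\<close>

definition tikhonov ::
    "('x \<Rightarrow> 'y::real_normed_vector) \<Rightarrow> ('x \<Rightarrow> ereal) \<Rightarrow> 'y \<Rightarrow> real \<Rightarrow> real \<Rightarrow> 'x \<Rightarrow> ereal"
  where "tikhonov K R g p \<alpha> u = ereal (norm (K u - g) powr p) + ereal \<alpha> * R u"

end

theory Submission
  imports Defs "HOL-Complex_Analysis.Great_Picard"
begin

text \<open>
  The direct method: by coercivity a minimizing sequence is bounded, and a weak* convergent
  subsequence has a minimizer as its limit, because \<open>J\<close> is sequentially weak* lower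
  semi-continuous.  When \<open>X\<^sub>*\<close> is separable, the subsequence comes from a diagonal argument over
  a countable dense set.  When \<open>X\<^sub>*\<close> is reflexive, the same argument works modulo the common kernel
  of the functionals, since by Hahn-Banach the quotient of \<open>X\<^sub>*\<close> by this kernel is separable.
\<close>

section \<open>Hahn-Banach\<close>

text \<open>Scaling is only an inequality, with the factor 0 included, because this form is easy to
  verify for infima; equality is recovered in \<open>sublinear_scaleR\<close>.\<close>

definition sublinear :: "('a::real_vector \<Rightarrow> real) \<Rightarrow> bool"
  where "sublinear q \<longleftrightarrow>
    (\<forall>x y. q (x + y) \<le> q x + q y) \<and> (\<forall>c x. 0 \<le> c \<longrightarrow> q (c *\<^sub>R x) \<le> c * q x)"

lemma sublinear_add: "sublinear q \<Longrightarrow> q (x + y) \<le> q x + q y"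
  and sublinear_scaleR_le: "sublinear q \<Longrightarrow> 0 \<le> c \<Longrightarrow> q (c *\<^sub>R x) \<le> c * q x"
  by (auto simp: sublinear_def)

lemma sublinear_0: "sublinear q \<Longrightarrow> q 0 = 0"
  using sublinear_add[of q 0 0] sublinear_scaleR_le[of q 0 0] by simp

text \<open>For a positive factor the reverse inequality is the defining one, applied with
  \<open>inverse c\<close> to the scaled vector.\<close>

lemma sublinear_scaleR:
  assumes q: "sublinear q" and "0 \<le> c"
  shows "q (c *\<^sub>R x) = c * q x"
proof (cases "c = 0")
  case False
  with assms(2) have c: "0 < c" by simp
  have "q x \<le> inverse c * q (c *\<^sub>R x)"
    using sublinear_scaleR_le[OF q, of "inverse c" "c *\<^sub>R x"] c by simp
  then have "c * q x \<le> q (c *\<^sub>R x)"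
    using c by (simp add: field_simps)
  then show ?thesis using sublinear_scaleR_le[OF q assms(2), of x] by simp
qed (simp add: sublinear_0[OF q])

lemma sublinear_minus_le: "sublinear q \<Longrightarrow> - q (- x) \<le> q x"
  using sublinear_add[of q x "- x"] sublinear_0[of q] by simp

text \<open>Take the infimum of \<open>q (x + t *\<^sub>R a) - t * q a\<close> over nonnegative
  \<open>t\<close>. The value at 0 shows that it lies below \<open>q\<close>; the value at 1 gives
  the bound at \<open>- a\<close>, since \<open>q 0 = 0\<close>.\<close>

lemma sublinear_directional:
  assumes q: "sublinear q"
  obtains q' where "sublinear q'" "q' \<le> q" "q' (- a) \<le> - q a"
proof -
  define h where "h x t = q (x + t *\<^sub>R a) - t * q a" for x t
  define q' where "q' x = (INF t\<in>{0..}. h x t)" for x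
  \<comment> \<open>The infimum is finite: \<open>t *\<^sub>R a\<close> is the sum of
    \<open>x + t *\<^sub>R a\<close> and \<open>- x\<close>, and \<open>q\<close> is
    subadditive.\<close>
  have lower: "- q (- x) \<le> h x t" if "0 \<le> t" for x t
    using sublinear_add[OF q, of "x + t *\<^sub>R a" "- x"] sublinear_scaleR[OF q that, of a]
    by (simp add: h_def)
  then have bdd: "bdd_below (h x ` {0..})" for x
    by (intro bdd_belowI2[of _ "- q (- x)"]) simp
  have q'_le: "q' x \<le> h x t" if "0 \<le> t" for x t
    unfolding q'_def using that by (intro cINF_lower bdd) simp
  have le_q': "m \<le> q' x" if "\<And>t. 0 \<le> t \<Longrightarrow> m \<le> h x t" for m x
    unfolding q'_def using that by (intro cINF_greatest) auto
  have "sublinear q'"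
    unfolding sublinear_def
  proof (intro conjI allI impI)
    fix x y
    \<comment> \<open>The infima are taken one after the other, first over \<open>s\<close>, then
      over \<open>t\<close>; on the left the parameter \<open>s + t\<close> is admissible.\<close>
    have "q' (x + y) - h y t \<le> h x s" if "0 \<le> s" "0 \<le> t" for s t
    proof -
      have eq: "x + y + (s + t) *\<^sub>R a = (x + s *\<^sub>R a) + (y + t *\<^sub>R a)"
        by (simp add: scaleR_add_left)
      have "q' (x + y) \<le> h (x + y) (s + t)" using that by (intro q'_le) simp
      also have "\<dots> \<le> h x s + h y t"
        unfolding h_def eq distrib_right
        using sublinear_add[OF q, of "x + s *\<^sub>R a" "y + t *\<^sub>R a"] by linarith
      finally show ?thesis by linarith
    qed
    then have "q' (x + y) - h y t \<le> q' x" if "0 \<le> t" for t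
      using that by (intro le_q')
    then have "q' (x + y) - q' x \<le> q' y"
      by (intro le_q') (simp add: algebra_simps)
    then show "q' (x + y) \<le> q' x + q' y" by simp
  next
    fix c :: real and x assume c: "0 \<le> c"
    show "q' (c *\<^sub>R x) \<le> c * q' x"
    proof (cases "c = 0")
      case True
      then show ?thesis using q'_le[of 0 0] sublinear_0[OF q] by (simp add: h_def)
    next
      case False
      then have c': "0 < c" using c by simp
      \<comment> \<open>Rescaling the parameter to \<open>c * t\<close> makes \<open>h\<close>
        homogeneous.\<close>
      have "q' (c *\<^sub>R x) / c \<le> h x t" if "0 \<le> t" for t
      proof -
        have "q' (c *\<^sub>R x) \<le> h (c *\<^sub>R x) (c * t)" using that c by (intro q'_le) simp
        also have "\<dots> = c * h x t"
          using sublinear_scaleR[OF q c, of "x + t *\<^sub>R a"] by (simp add: h_def algebra_simps)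
        finally show ?thesis using c' by (simp add: field_simps)
      qed
      then have "q' (c *\<^sub>R x) / c \<le> q' x" by (rule le_q')
      then show ?thesis using c' by (simp add: field_simps)
    qed
  qed
  moreover have "q' \<le> q" using q'_le[of 0] by (auto simp: le_fun_def h_def)
  moreover have "q' (- a) \<le> - q a" using q'_le[of 1 "- a"] sublinear_0[OF q] by (simp add: h_def)
  ultimately show ?thesis by (rule that)
qed

text \<open>Zorn's lemma for the reversed order. A nonempty chain is bounded below by its pointwise
  infimum, which is finite because every member satisfies
  \<open>- q (- x) \<le> - f (- x) \<le> f x\<close>.\<close>

lemma minimal_sublinear_le:
  assumes q: "sublinear q"
  obtains f where "sublinear f" "f \<le> q" "\<And>f'. sublinear f' \<Longrightarrow> f' \<le> f \<Longrightarrow> f' = f"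
proof -
  let ?A = "{f. sublinear f \<and> f \<le> q}"
  have "\<exists>m\<in>?A. \<forall>a\<in>?A. m \<ge> a \<longrightarrow> a = m"
  proof (rule predicate_Zorn)
    show "partial_order_on ?A (relation_of (\<ge>) ?A)"
      by (rule partial_order_on_relation_ofI) auto
  next
    fix C assume "C \<in> Chains (relation_of (\<ge>) ?A)"
    then have C: "C \<subseteq> ?A" and chain: "\<And>f g. f \<in> C \<Longrightarrow> g \<in> C \<Longrightarrow> f \<le> g \<or> g \<le> f"
      by (auto simp: Chains_def relation_of_def)
    show "\<exists>u\<in>?A. \<forall>a\<in>C. u \<le> a"
    proof (cases "C = {}")
      case True
      then show ?thesis using q by auto
    next
      case False
      define u where "u x = (INF f\<in>C. f x)" for x
      have "- q (- x) \<le> f x" if "f \<in> C" for f x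
      proof -
        have "sublinear f" "f (- x) \<le> q (- x)" using that C by (auto simp: le_fun_def)
        then show ?thesis using sublinear_minus_le[of f x] by linarith
      qed
      then have bdd: "bdd_below ((\<lambda>f. f x) ` C)" for x
        by (intro bdd_belowI2[of _ "- q (- x)"])
      have u_le: "u x \<le> f x" if "f \<in> C" for x f
        unfolding u_def using that by (intro cINF_lower bdd)
      have le_u: "m \<le> u x" if "\<And>f. f \<in> C \<Longrightarrow> m \<le> f x" for m x
        unfolding u_def using that False by (intro cINF_greatest) auto
      have "sublinear u"
        unfolding sublinear_def
      proof (intro conjI allI impI)
        fix x y
        have "u (x + y) - g y \<le> f x" if fg: "f \<in> C" "g \<in> C" for f g
        proof -
          \<comment> \<open>Subadditivity of the infimum mixes two members of the chain, so both are
            replaced by the smaller one.\<close>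
          obtain k where k: "k \<in> C" "k \<le> f" "k \<le> g" using chain[OF fg] fg by auto
          have "u (x + y) \<le> k (x + y)" by (rule u_le[OF k(1)])
          also have "\<dots> \<le> k x + k y" using k(1) C by (auto intro: sublinear_add)
          also have "\<dots> \<le> f x + g y" by (rule add_mono[OF le_funD[OF k(2)] le_funD[OF k(3)]])
          finally show ?thesis by simp
        qed
        then have "u (x + y) - g y \<le> u x" if "g \<in> C" for g
          using that by (intro le_u)
        then have "u (x + y) - u x \<le> u y"
          by (intro le_u) (simp add: algebra_simps)
        then show "u (x + y) \<le> u x + u y" by simp
      next
        fix c :: real and x assume c: "0 \<le> c"
        have *: "u (c *\<^sub>R x) \<le> c * f x" if "f \<in> C" for f
          using u_le[OF that, of "c *\<^sub>R x"] sublinear_scaleR[of f c x] c C that by auto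
        show "u (c *\<^sub>R x) \<le> c * u x"
        proof (cases "c = 0")
          case True
          then show ?thesis using * False by auto
        next
          case False
          with c have "0 < c" by simp
          then have "u (c *\<^sub>R x) / c \<le> u x"
            using * by (intro le_u) (simp add: field_simps)
          then show ?thesis using \<open>0 < c\<close> by (simp add: field_simps)
        qed
      qed
      moreover have "u \<le> q"
      proof -
        obtain f where "f \<in> C" "f \<le> q" using False C by blast
        then show ?thesis using u_le by (meson le_fun_def order_trans)
      qed
      ultimately show ?thesis using u_le by (auto simp: le_fun_def)
    qed
  qed
  then obtain m where m: "sublinear m" "m \<le> q" "\<And>f. f \<in> ?A \<Longrightarrow> f \<le> m \<Longrightarrow> f = m" by auto
  have "f = m" if "sublinear f" "f \<le> m" for f
    using that m(2) order_trans by (intro m(3)) blast+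
  with m(1,2) show ?thesis by (rule that)
qed

text \<open>A minimal sublinear functional is odd, since otherwise \<open>sublinear_directional\<close> would
  decrease it; an odd sublinear functional is linear.\<close>

lemma linear_le_sublinear:
  assumes q: "sublinear q"
  obtains f where "linear f" "\<And>x. f x \<le> q x" "f a = q a"
proof -
  \<comment> \<open>Lowering the value at \<open>- a\<close> before minimizing forces equality at
    \<open>a\<close>: once \<open>f\<close> is odd, \<open>f a = - f (- a)\<close> is at least
    \<open>q a\<close>.\<close>
  obtain q' where q': "sublinear q'" "q' \<le> q" "q' (- a) \<le> - q a"
    using sublinear_directional[OF q] .
  obtain f where f: "sublinear f" "f \<le> q'" and min: "\<And>f'. sublinear f' \<Longrightarrow> f' \<le> f \<Longrightarrow> f' = f"
    by (rule minimal_sublinear_le[OF q'(1)]) blast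
  have minus: "f (- x) = - f x" for x
  proof -
    obtain f' where "sublinear f'" "f' \<le> f" "f' (- x) \<le> - f x"
      using sublinear_directional[OF f(1)] .
    moreover from this have "f' = f" by (intro min)
    ultimately have "f (- x) \<le> - f x" by simp
    then show ?thesis using sublinear_minus_le[OF f(1), of "- x"] by simp
  qed
  have "linear f"
  proof (rule linearI)
    fix x y
    show "f (x + y) = f x + f y"
      using sublinear_add[OF f(1), of x y] sublinear_add[OF f(1), of "- x" "- y"]
        minus[of "x + y"] minus[of x] minus[of y] by simp
  next
    fix c x
    show "f (c *\<^sub>R x) = c *\<^sub>R f x"
    proof (cases "0 \<le> c")
      case False
      then have "f ((- c) *\<^sub>R x) = (- c) * f x" by (intro sublinear_scaleR f) simp
      then show ?thesis using minus[of "c *\<^sub>R x"] by simp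
    qed (simp add: sublinear_scaleR[OF f(1)])
  qed
  moreover have le: "f x \<le> q x" for x
    using f(2) q'(2) by (meson le_funD order_trans)
  moreover have "f a = q a"
    using minus[of a] le[of a] le_funD[OF f(2), of "- a"] q'(3) by simp
  ultimately show ?thesis by (rule that)
qed

section \<open>Separation of a point from a closed subspace\<close>

text \<open>Sums and multiples of near-optimal points of \<open>M\<close> stay in \<open>M\<close>
  and compete in the infimum for the sum or the multiple.\<close>

lemma sublinear_infdist:
  fixes M :: "'a::real_normed_vector set"
  assumes M: "subspace M"
  shows "sublinear (\<lambda>x. infdist x M)"
proof -
  have ne: "M \<noteq> {}" using subspace_0[OF M] by auto
  have approx: "\<exists>m\<in>M. dist x m < infdist x M + e" if "0 < e" for x e
    using cINF_less_iff[OF ne, of "dist x" "infdist x M + e"] that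
    by (auto simp: infdist_notempty[OF ne])
  show ?thesis
    unfolding sublinear_def
  proof (intro conjI allI impI)
    fix x y
    show "infdist (x + y) M \<le> infdist x M + infdist y M"
    proof (rule field_le_epsilon)
      fix e :: real assume "0 < e"
      then obtain m n where "m \<in> M" "n \<in> M"
        and le: "dist x m < infdist x M + e / 2" "dist y n < infdist y M + e / 2"
        using approx[of "e / 2"] by (meson half_gt_zero)
      then have "infdist (x + y) M \<le> dist (x + y) (m + n)"
        by (intro infdist_le subspace_add[OF M])
      also have "\<dots> \<le> dist x m + dist y n" by (rule dist_triangle_add)
      finally show "infdist (x + y) M \<le> infdist x M + infdist y M + e" using le by simp
    qed
  next
    fix c :: real and x assume c: "0 \<le> c"
    show "infdist (c *\<^sub>R x) M \<le> c * infdist x M"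
    proof (rule field_le_epsilon)
      fix e :: real assume e: "0 < e"
      \<comment> \<open>The denominator \<open>c + 1\<close> also covers
        \<open>c = 0\<close>.\<close>
      then have "0 < e / (c + 1)" using c by simp
      then obtain m where m: "m \<in> M" "dist x m < infdist x M + e / (c + 1)"
        using approx by blast
      have "infdist (c *\<^sub>R x) M \<le> dist (c *\<^sub>R x) (c *\<^sub>R m)"
        using m by (intro infdist_le subspace_scale[OF M])
      also have "\<dots> = c * dist x m"
        using c by (simp add: dist_norm flip: scaleR_diff_right)
      also have "\<dots> \<le> c * (infdist x M + e / (c + 1))"
        using m c by (intro mult_left_mono) auto
      also have "\<dots> \<le> c * infdist x M + e" using c e by (simp add: field_simps)
      finally show "infdist (c *\<^sub>R x) M \<le> c * infdist x M + e" .
    qed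
  qed
qed

text \<open>Hahn-Banach is applied to the distance from \<open>M\<close>, with equality at
  \<open>a\<close>. Since \<open>M\<close> is symmetric, the distance bounds the absolute value of
  \<open>f\<close>. It is zero on \<open>M\<close>, at most the norm because 0 lies in
  \<open>M\<close>, and positive at \<open>a\<close> because \<open>M\<close> is closed.\<close>

lemma separate_closed_subspace:
  fixes M :: "'a::real_normed_vector set"
  assumes "subspace M" "closed M" "a \<notin> M"
  obtains f :: "'a \<Rightarrow>\<^sub>L real" where "\<And>x. x \<in> M \<Longrightarrow> f x = 0" "f a \<noteq> 0"
proof -
  have 0: "0 \<in> M" by (rule subspace_0[OF assms(1)])
  obtain f where lin: "linear f" and le: "\<And>x. f x \<le> infdist x M" and fa: "f a = infdist a M"
    using linear_le_sublinear[OF sublinear_infdist[OF assms(1)], of a] by blast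
  have abs_le: "\<bar>f x\<bar> \<le> infdist x M" for x
  proof -
    have "infdist (- x) M \<le> infdist x M"
    proof -
      have "infdist (- x) M \<le> dist x m" if "m \<in> M" for m
        using infdist_le[OF subspace_neg[OF assms(1) that], of "- x"]
        by (simp add: dist_minus)
      then have "infdist (- x) M \<le> (INF m\<in>M. dist x m)" using 0 by (intro cINF_greatest) auto
      then show ?thesis using 0 by (subst (2) infdist_notempty) auto
    qed
    then show ?thesis using le[of x] le[of "- x"] linear_neg[OF lin, of x] by simp
  qed
  have "infdist x M \<le> norm x" for x using infdist_le[OF 0, of x] by simp
  then have "\<bar>f x\<bar> \<le> norm x * 1" for x using abs_le[of x] by (smt (verit) mult.right_neutral)
  then have "bounded_linear f"
    using lin by (intro bounded_linear_intro[where K=1]) (auto simp: linear_add linear_cmul)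
  then have "blinfun_apply (Blinfun f) = f" by (rule bounded_linear_Blinfun_apply)
  moreover have "f x = 0" if "x \<in> M" for x using abs_le[of x] that by simp
  moreover have "f a \<noteq> 0"
    using infdist_pos_not_in_closed[OF assms(2) _ assms(3)] 0 fa by fastforce
  ultimately show ?thesis using that[of "Blinfun f"] by auto
qed

section \<open>Weak* sequential compactness\<close>

lemma subspace_convergent_blinfun:
  fixes f :: "nat \<Rightarrow> 'a::real_normed_vector \<Rightarrow>\<^sub>L real"
  shows "subspace {x. convergent (\<lambda>n. f n x)}"
  by (rule subspaceI)
     (auto simp: blinfun.bilinear_simps intro: convergent_add convergent_mult convergent_const)

text \<open>The common bound makes the functionals equicontinuous, so the Cauchy property passes
  from a nearby point \<open>y\<close> to \<open>x\<close> by splitting the error into three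
  parts.\<close>

lemma closed_convergent_blinfun:
  fixes f :: "nat \<Rightarrow> 'a::real_normed_vector \<Rightarrow>\<^sub>L real"
  assumes B: "\<And>n. norm (f n) \<le> B"
  shows "closed {x. convergent (\<lambda>n. f n x)}"
proof -
  have "x \<in> {x. convergent (\<lambda>n. f n x)}" if "x \<in> closure {x. convergent (\<lambda>n. f n x)}" for x
  proof -
    have B0: "0 \<le> B" using B[of 0] norm_ge_zero order_trans by blast
    have "Cauchy (\<lambda>n. f n x)"
    proof (rule metric_CauchyI)
      fix e :: real assume e: "0 < e"
      \<comment> \<open>\<open>B + 1\<close> instead of \<open>B\<close> keeps the denominator
        positive when \<open>B = 0\<close>.\<close>
      then have "0 < e / (3 * (B + 1))" using B0 by simp
      then have "\<exists>y\<in>{x. convergent (\<lambda>n. f n x)}. dist y x < e / (3 * (B + 1))"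
        using that[unfolded closure_approachable] by blast
      then obtain y where y: "convergent (\<lambda>n. f n y)" "dist y x < e / (3 * (B + 1))"
        by (elim bexE) simp
      have "norm (f n y - f n x) < e / 3" for n
      proof -
        have "norm (f n y - f n x) \<le> norm (f n) * norm (y - x)"
          by (metis blinfun.diff_right norm_blinfun)
        also have "\<dots> \<le> (B + 1) * norm (y - x)"
          using B[of n] by (intro mult_right_mono) auto
        also have "\<dots> < e / 3" using y(2) B0 by (simp add: dist_norm field_simps)
        finally show ?thesis .
      qed
      then have near: "dist (f n y) (f n x) < e / 3" for n by (simp add: dist_norm)
      obtain N where N: "\<And>m n. m \<ge> N \<Longrightarrow> n \<ge> N \<Longrightarrow> dist (f m y) (f n y) < e / 3"
        using metric_CauchyD[OF convergent_Cauchy[OF y(1)], of "e / 3"] e by auto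
      have "dist (f m x) (f n x) < e" if "m \<ge> N" "n \<ge> N" for m n
        using N[OF that] near[of m] near[of n] unfolding dist_real_def by linarith
      then show "\<exists>N. \<forall>m\<ge>N. \<forall>n\<ge>N. dist (f m x) (f n x) < e" by blast
    qed
    then show ?thesis by (simp add: Cauchy_convergent)
  qed
  then show ?thesis by (metis closure_subset_eq subsetI)
qed

text \<open>Linearity and the bound \<open>norm x * B\<close> both survive pointwise limits.\<close>

lemma blinfun_pointwise_limit:
  fixes f :: "nat \<Rightarrow> 'a::real_normed_vector \<Rightarrow>\<^sub>L real"
  assumes B: "\<And>n. norm (f n) \<le> B" and conv: "\<And>x. convergent (\<lambda>n. f n x)"
  obtains l :: "'a \<Rightarrow>\<^sub>L real" where "\<And>x. (\<lambda>n. f n x) \<longlonglongrightarrow> l x"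
proof -
  define l where "l x = lim (\<lambda>n. f n x)" for x
  have l: "(\<lambda>n. f n x) \<longlonglongrightarrow> l x" for x
    using conv by (simp add: l_def convergent_LIMSEQ_iff)
  have "bounded_linear l"
  proof (rule bounded_linear_intro[where K=B])
    fix x y
    show "l (x + y) = l x + l y"
      using l[of "x + y"] tendsto_add[OF l[of x] l[of y]]
      by (auto simp: blinfun.bilinear_simps intro: LIMSEQ_unique)
  next
    fix c x
    show "l (c *\<^sub>R x) = c *\<^sub>R l x"
      using l[of "c *\<^sub>R x"] tendsto_scaleR[OF tendsto_const l[of x], of c]
      by (auto simp: blinfun.bilinear_simps intro: LIMSEQ_unique)
  next
    fix x
    have "norm (f n x) \<le> norm x * B" for n
      using norm_blinfun[of "f n" x] mult_right_mono[OF B[of n], of "norm x"]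
      by (simp add: mult.commute)
    then show "norm (l x) \<le> norm x * B"
      by (intro LIMSEQ_le_const2[OF tendsto_norm[OF l]]) auto
  qed
  then show ?thesis using l that[of "Blinfun l"] by (simp add: bounded_linear_Blinfun_apply)
qed

text \<open>On the common kernel every subsequence converges trivially, so only countably many
  further points have to be handled by a diagonal argument.\<close>

lemma bounded_blinfun_seq_convergent_subseq:
  fixes f :: "nat \<Rightarrow> 'a::real_normed_vector \<Rightarrow>\<^sub>L real"
  assumes B: "\<And>n. norm (f n) \<le> B" and "countable D"
    and total: "\<And>M. subspace M \<Longrightarrow> closed M \<Longrightarrow> D \<subseteq> M \<Longrightarrow> {x. \<forall>n. f n x = 0} \<subseteq> M \<Longrightarrow> M = UNIV"
  obtains r :: "nat \<Rightarrow> nat" and l :: "'a \<Rightarrow>\<^sub>L real"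
    where "strict_mono r" "\<And>x. (\<lambda>n. f (r n) x) \<longlonglongrightarrow> l x"
proof -
  \<comment> \<open>The diagonal argument in \<open>function_convergent_subsequence\<close> asks for
    one bound for all points; dividing by \<open>1 + norm x\<close> provides it and is undone on
    \<open>D\<close> below.\<close>
  have "norm (f n x / (1 + norm x)) \<le> B" for n x
  proof -
    have "norm (f n x) \<le> norm (f n) * norm x" by (rule norm_blinfun)
    also have "\<dots> \<le> B * (1 + norm x)"
      using B[of n] order_trans[OF norm_ge_zero B[of n]] by (intro mult_mono) auto
    finally show ?thesis
      using norm_ge_zero[of x] by (simp add: pos_divide_le_eq add_pos_nonneg)
  qed
  then obtain r :: "nat \<Rightarrow> nat" where r: "strict_mono r"
    and conv: "\<And>x. x \<in> D \<Longrightarrow> \<exists>l. (\<lambda>n. f (r n) x / (1 + norm x)) \<longlonglongrightarrow> l"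
    using function_convergent_subsequence[OF \<open>countable D\<close>, of "\<lambda>n x. f n x / (1 + norm x)" B]
    by blast
  let ?M = "{x. convergent (\<lambda>n. f (r n) x)}"
  have "?M = UNIV"
  proof (rule total)
    show "subspace ?M" by (rule subspace_convergent_blinfun)
    show "closed ?M" by (rule closed_convergent_blinfun) (rule B)
    show "D \<subseteq> ?M"
    proof
      fix x assume "x \<in> D"
      then obtain l where "(\<lambda>n. f (r n) x / (1 + norm x)) \<longlonglongrightarrow> l" using conv by blast
      then have "(\<lambda>n. f (r n) x / (1 + norm x) * (1 + norm x)) \<longlonglongrightarrow> l * (1 + norm x)"
        by (intro tendsto_intros)
      moreover have "1 + norm x \<noteq> 0" using norm_ge_zero[of x] by linarith
      ultimately show "x \<in> ?M" by (auto simp: convergent_def)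
    qed
    show "{x. \<forall>n. f n x = 0} \<subseteq> ?M" by (auto simp: convergent_const)
  qed
  then have "convergent (\<lambda>n. f (r n) x)" for x by blast
  then obtain l :: "'a \<Rightarrow>\<^sub>L real" where "\<And>x. (\<lambda>n. f (r n) x) \<longlonglongrightarrow> l x"
    using blinfun_pointwise_limit[of "\<lambda>n. f (r n)" B] B by blast
  then show ?thesis using that r by blast
qed

section \<open>Countable total sets\<close>

text \<open>\<open>G\<close> consists of the rational combinations. Its closure admits real scalars
  because the rationals are dense, hence is a subspace and contains the span.\<close>

lemma countable_dense_span_range:
  fixes f :: "nat \<Rightarrow> 'a::real_normed_vector"
  obtains G where "countable G" "span (range f) \<subseteq> closure G"
proof -
  \<comment> \<open>Indexing by lists over a countable type makes the range countable; concatenation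
    of lists gives sums.\<close>
  define c where "c w = (\<Sum>(q, i)\<leftarrow>w. of_rat q *\<^sub>R f i)" for w :: "(rat \<times> nat) list"
  have c_add: "c (v @ w) = c v + c w" for v w by (simp add: c_def)
  have c_scale: "c (map (\<lambda>(p, i). (q * p, i)) w) = of_rat q *\<^sub>R c w" for q w
    by (induction w) (auto simp: c_def algebra_simps of_rat_mult)
  have scale: "r *\<^sub>R c w \<in> closure (range c)" for r w
  proof -
    have "r \<in> closure \<rat>" by (simp add: Rats_closure_real)
    then obtain q where q: "\<And>n. q n \<in> \<rat>" "q \<longlonglongrightarrow> r" by (auto simp: closure_sequential)
    have "q n *\<^sub>R c w \<in> range c" for n
    proof -
      obtain p where "q n = of_rat p" using q(1)[of n] by (auto elim: Rats_cases)
      then show ?thesis using c_scale[of p w] by (metis rangeI)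
    qed
    moreover have "(\<lambda>n. q n *\<^sub>R c w) \<longlonglongrightarrow> r *\<^sub>R c w" using q(2) by (intro tendsto_intros)
    ultimately show ?thesis unfolding closure_sequential by (intro exI[of _ "\<lambda>n. q n *\<^sub>R c w"]) simp
  qed
  have "subspace (closure (range c))"
  proof (rule subspaceI)
    show "0 \<in> closure (range c)"
      using closure_subset[of "range c"] rangeI[of c "[]"] by (auto simp: c_def)
  next
    fix x y assume "x \<in> closure (range c)" "y \<in> closure (range c)"
    then obtain v w where "\<And>n. v n \<in> range c" "v \<longlonglongrightarrow> x" "\<And>n. w n \<in> range c" "w \<longlonglongrightarrow> y"
      by (auto simp: closure_sequential)
    moreover from this have "v n + w n \<in> range c" for n by (metis c_add imageE rangeI)
    ultimately show "x + y \<in> closure (range c)"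
      unfolding closure_sequential
      by (intro exI[of _ "\<lambda>n. v n + w n"]) (simp add: tendsto_add)
  next
    fix r x assume "x \<in> closure (range c)"
    then obtain v where v: "\<And>n. v n \<in> range c" "v \<longlonglongrightarrow> x" by (auto simp: closure_sequential)
    have "r *\<^sub>R v n \<in> closure (range c)" for n using scale v(1)[of n] by auto
    moreover have "(\<lambda>n. r *\<^sub>R v n) \<longlonglongrightarrow> r *\<^sub>R x" using v(2) by (intro tendsto_intros)
    ultimately show "r *\<^sub>R x \<in> closure (range c)"
      by (rule closed_sequentially[OF closed_closure])
  qed
  moreover have "range f \<subseteq> closure (range c)"
  proof -
    have "f i = c [(1, i)]" for i by (simp add: c_def)
    then show ?thesis using closure_subset[of "range c"] by auto
  qed
  ultimately have "span (range f) \<subseteq> closure (range c)" by (intro span_minimal)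
  then show ?thesis using that[of "range c"] by blast
qed

text \<open>By reflexivity a functional that vanishes on the common kernel of the \<open>f n\<close> lies in the
  closed span of the \<open>f n\<close>.  It is therefore a limit of members of a countable set, and it
  vanishes if it annihilates a vector that almost norms each of these.\<close>

lemma reflexive_countable_total:
  fixes f :: "nat \<Rightarrow> 'p::banach \<Rightarrow>\<^sub>L real"
  assumes refl: "reflexive TYPE('p)"
  obtains D where "countable D"
    "\<And>M. subspace M \<Longrightarrow> closed M \<Longrightarrow> D \<subseteq> M \<Longrightarrow> {x. \<forall>n. f n x = 0} \<subseteq> M \<Longrightarrow> M = UNIV"
proof -
  obtain G where G: "countable G" "span (range f) \<subseteq> closure G"
    by (rule countable_dense_span_range)
  \<comment> \<open>The norm need not be attained, hence the factor 2; requiring \<open>x\<close> to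
    be nonzero excludes the trivial choice.\<close>
  have "\<exists>x. norm g * norm x \<le> 2 * \<bar>g x\<bar> \<and> (g \<noteq> 0 \<longrightarrow> x \<noteq> 0)" for g :: "'p \<Rightarrow>\<^sub>L real"
  proof (cases "g = 0")
    case False
    have "\<exists>x. norm g / 2 * norm x < \<bar>g x\<bar>"
    proof (rule ccontr)
      assume "\<nexists>x. norm g / 2 * norm x < \<bar>g x\<bar>"
      then have "norm g \<le> norm g / 2" by (intro norm_blinfun_bound) (auto simp: not_less)
      then show False using False by simp
    qed
    then obtain x where x: "norm g / 2 * norm x < \<bar>g x\<bar>" by blast
    then have "x \<noteq> 0" by auto
    then show ?thesis using x by (intro exI[of _ x]) simp
  qed auto
  then obtain d :: "('p \<Rightarrow>\<^sub>L real) \<Rightarrow> 'p"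
    where d: "\<And>g. norm g * norm (d g) \<le> 2 * \<bar>g (d g)\<bar>" "\<And>g. g \<noteq> 0 \<Longrightarrow> d g \<noteq> 0"
    by metis
  have "M = UNIV" if M: "subspace M" "closed M" "d ` G \<subseteq> M" "{x. \<forall>n. f n x = 0} \<subseteq> M" for M
  proof (rule ccontr)
    assume "M \<noteq> UNIV"
    then obtain a where "a \<notin> M" by auto
    then obtain h :: "'p \<Rightarrow>\<^sub>L real" where h: "\<And>x. x \<in> M \<Longrightarrow> h x = 0" "h a \<noteq> 0"
      using separate_closed_subspace M by blast
    \<comment> \<open>Otherwise a functional on the dual separates \<open>h\<close> from the closed
      span. By reflexivity it is evaluation at some \<open>x\<close>, which then lies in the common
      kernel and so in \<open>M\<close>, where \<open>h\<close> vanishes.\<close>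
    have "h \<in> closure (span (range f))"
    proof (rule ccontr)
      assume "h \<notin> closure (span (range f))"
      then obtain \<Psi> :: "('p \<Rightarrow>\<^sub>L real) \<Rightarrow>\<^sub>L real"
        where \<Psi>: "\<And>k. k \<in> closure (span (range f)) \<Longrightarrow> \<Psi> k = 0" "\<Psi> h \<noteq> 0"
        using separate_closed_subspace[OF subspace_closure[OF subspace_span] closed_closure] by blast
      obtain x where x: "\<And>k. \<Psi> k = blinfun_apply k x" using refl unfolding reflexive_def by blast
      have "f n x = 0" for n
        using \<Psi>(1)[of "f n"] x[of "f n"] closure_subset[of "span (range f)"] span_base[of "f n" "range f"]
        by auto
      then have "h x = 0" using M(4) h(1) by blast
      then show False using \<Psi>(2) x by simp
    qed
    then have hG: "h \<in> closure G" using G(2) closure_minimal[OF G(2) closed_closure] by blast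
    have "norm h > 0" using h(2) by (metis blinfun.zero_left zero_less_norm_iff)
    \<comment> \<open>With \<open>h (d g) = 0\<close>, the choice of \<open>d\<close> gives
      \<open>norm g \<le> 2 * dist g h\<close>, hence \<open>norm h \<le> 3 * dist g h\<close>; the
      radius \<open>norm h / 3\<close> makes this a contradiction.\<close>
    then obtain g where g: "g \<in> G" "dist g h < norm h / 3"
      using hG unfolding closure_approachable by (metis zero_less_divide_iff zero_less_numeral)
    have gh: "norm h \<le> norm g + dist g h"
      using norm_triangle_sub[of h g] by (simp add: dist_norm norm_minus_commute)
    then have "g \<noteq> 0" using g(2) \<open>norm h > 0\<close> by auto
    then have dpos: "norm (d g) > 0" using d(2) by simp
    have "h (d g) = 0" using h(1) M(3) g(1) by blast
    then have "\<bar>g (d g)\<bar> = norm ((g - h) (d g))" by (simp add: blinfun.diff_left)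
    also have "\<dots> \<le> dist g h * norm (d g)" unfolding dist_norm by (rule norm_blinfun)
    finally have "norm g * norm (d g) \<le> (2 * dist g h) * norm (d g)" using d(1)[of g] by simp
    then have "norm g \<le> 2 * dist g h" using dpos by simp
    then show False using g(2) gh by simp
  qed
  then show ?thesis using that[of "d ` G"] G(1) by blast
qed

section \<open>Bounded sequences in a dual space\<close>

text \<open>The two alternatives differ only in the source of the countable set \<open>D\<close>: a
  dense set in the separable case, \<open>reflexive_countable_total\<close> in the reflexive
  one.\<close>

lemma bounded_dual_seq_convergent_subseq:
  fixes f :: "nat \<Rightarrow> 'p::banach \<Rightarrow>\<^sub>L real"
  assumes "separable_space (euclidean :: 'p topology) \<or> reflexive TYPE('p)"
    and B: "\<And>n. norm (f n) \<le> B"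
  obtains r :: "nat \<Rightarrow> nat" and l :: "'p \<Rightarrow>\<^sub>L real"
    where "strict_mono r" "\<And>x. (\<lambda>n. f (r n) x) \<longlonglongrightarrow> l x"
proof -
  obtain D where D: "countable D"
    "\<And>M. subspace M \<Longrightarrow> closed M \<Longrightarrow> D \<subseteq> M \<Longrightarrow> {x. \<forall>n. f n x = 0} \<subseteq> M \<Longrightarrow> M = UNIV"
    using assms(1)
  proof
    assume "separable_space (euclidean :: 'p topology)"
    then obtain D :: "'p set" where D: "countable D" "closure D = UNIV"
      by (auto simp: separable_space_def)
    have "M = UNIV" if "closed M" "D \<subseteq> M" for M
      using closure_minimal[OF that(2,1)] D(2) by blast
    then show ?thesis using that D(1) by blast
  next
    assume "reflexive TYPE('p)"
    then show ?thesis using that reflexive_countable_total[of f] by blast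
  qed
  show ?thesis
    by (rule bounded_blinfun_seq_convergent_subseq[OF B D]) (assumption | rule that)+
qed

text \<open>The isometry carries the bound to the dual, and surjectivity turns the limit functional
  into an element of the original space.\<close>

lemma predual_bounded_seq_convergent_subseq:
  fixes \<phi> :: "'x::banach \<Rightarrow> ('p::banach \<Rightarrow>\<^sub>L real)"
  assumes \<phi>: "predual \<phi>"
    and "separable_space (euclidean :: 'p topology) \<or> reflexive TYPE('p)"
    and "\<And>n. norm (u n) \<le> B"
  obtains r :: "nat \<Rightarrow> nat" and l
    where "strict_mono r" "limitin (weak_star_topology \<phi>) (u \<circ> r) l sequentially"
proof -
  have "norm (\<phi> (u n)) \<le> B" for n using \<phi> assms(3) by (simp add: predual_def)
  then obtain r :: "nat \<Rightarrow> nat" and l' :: "'p \<Rightarrow>\<^sub>L real"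
    where r: "strict_mono r" and l': "\<And>x. (\<lambda>n. \<phi> (u (r n)) x) \<longlonglongrightarrow> l' x"
    using bounded_dual_seq_convergent_subseq[OF assms(2), of "\<lambda>n. \<phi> (u n)"] by blast
  obtain l where "l' = \<phi> l" using \<phi> unfolding predual_def by (meson surjE)
  then show ?thesis using that[OF r, of l] l' by (simp add: limitin_weak_star)
qed

section \<open>Existence of minimizers\<close>

text \<open>The norm is a supremum of weak* continuous functions: one predual vector
  \<open>x\<close> witnesses that \<open>c\<close> is exceeded at the limit, and the same
  \<open>x\<close> is eventually a witness along the filter.\<close>

lemma weak_star_eventually_norm_gt:
  assumes \<phi>: "predual \<phi>" and lim: "limitin (weak_star_topology \<phi>) u l F"
    and c: "0 \<le> c" "c < norm (l - g)"
  shows "\<forall>\<^sub>F n in F. c < norm (u n - g)"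
proof -
  have diff: "\<phi> (x - g) = \<phi> x - \<phi> g" for x using \<phi> by (simp add: predual_def linear_diff)
  have nrm: "norm (\<phi> x) = norm x" for x using \<phi> by (simp add: predual_def)
  have "\<exists>x. c * norm x < \<bar>\<phi> (l - g) x\<bar>"
  proof (rule ccontr)
    assume "\<nexists>x. c * norm x < \<bar>\<phi> (l - g) x\<bar>"
    then have "norm (\<phi> (l - g)) \<le> c" using c by (intro norm_blinfun_bound) (auto simp: not_less)
    then show False using c nrm by simp
  qed
  then obtain x where x: "c * norm x < \<bar>\<phi> (l - g) x\<bar>" by blast
  have "((\<lambda>n. \<phi> (u n) x) \<longlongrightarrow> \<phi> l x) F" using lim by (simp add: limitin_weak_star)
  then have "((\<lambda>n. \<bar>\<phi> (u n - g) x\<bar>) \<longlongrightarrow> \<bar>\<phi> (l - g) x\<bar>) F"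
    unfolding diff blinfun.diff_left by (intro tendsto_rabs tendsto_diff tendsto_const)
  then have "\<forall>\<^sub>F n in F. c * norm x < \<bar>\<phi> (u n - g) x\<bar>" using x by (rule order_tendstoD)
  then show ?thesis
  proof eventually_elim
    case (elim n)
    then have "c * norm x < norm (u n - g) * norm x"
      using norm_blinfun[of "\<phi> (u n - g)" x] nrm by simp
    then show ?case by (simp add: mult_less_cancel_right)
  qed
qed

text \<open>The power is increasing on nonnegative reals, so lower bounds for it translate into
  lower bounds for the norm.\<close>

lemma weak_star_norm_powr_le_liminf:
  assumes "predual \<phi>" and "limitin (weak_star_topology \<phi>) u l F" and p: "0 < p"
  shows "ereal (norm (l - g) powr p) \<le> Liminf F (\<lambda>n. ereal (norm (u n - g) powr p))"
  unfolding le_Liminf_iff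
proof (intro allI impI)
  fix y assume y: "y < ereal (norm (l - g) powr p)"
  show "\<forall>\<^sub>F n in F. y < ereal (norm (u n - g) powr p)"
  proof (cases "y < 0")
    case True
    have "0 \<le> ereal (norm (u n - g) powr p)" for n by simp
    then show ?thesis using True by (intro always_eventually allI) (rule less_le_trans)
  next
    case False
    then obtain z where z: "y = ereal z" "0 \<le> z" using y by (cases y) auto
    \<comment> \<open>The threshold for the norm that corresponds to \<open>z\<close> for its power;
      taking the root requires \<open>z\<close> to be nonnegative, hence the case split.\<close>
    define c where "c = z powr (1 / p)"
    have cp: "c powr p = z" using p z(2) by (simp add: c_def powr_powr)
    have "c < norm (l - g)"
    proof (rule ccontr)
      assume "\<not> c < norm (l - g)"
      then have "norm (l - g) powr p \<le> c powr p" using p by (intro powr_mono2) auto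
      then show False using y z cp by simp
    qed
    then have "\<forall>\<^sub>F n in F. c < norm (u n - g)"
      by (intro weak_star_eventually_norm_gt[OF assms(1,2)]) (simp add: c_def)
    then show ?thesis
    proof eventually_elim
      case (elim n)
      then have "c powr p < norm (u n - g) powr p" using p by (intro powr_less_mono2) (auto simp: c_def)
      then show ?case using cp z by simp
    qed
  qed
qed

text \<open>Continuity of \<open>K\<close> turns convergence in \<open>T\<close> into weak*
  convergence of the images, where the power of the norm is lower semi-continuous. The two terms are
  then added.\<close>

lemma seq_lsc_tikhonov:
  assumes \<psi>: "predual \<psi>" and nonneg: "\<And>u. 0 \<le> R u" and p: "0 < p" and \<alpha>: "0 \<le> \<alpha>"
    and R: "seq_lsc T R" and K: "seq_continuous T (weak_star_topology \<psi>) K"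
  shows "seq_lsc T (tikhonov K R g p \<alpha>)"
  unfolding seq_lsc_def
proof (intro allI impI)
  fix u l assume lim: "limitin T u l sequentially"
  let ?a = "\<lambda>n. ereal (norm (K (u n) - g) powr p)" and ?b = "\<lambda>n. ereal \<alpha> * R (u n)"
  have a: "ereal (norm (K l - g) powr p) \<le> liminf ?a"
    using K lim p by (intro weak_star_norm_powr_le_liminf[OF \<psi>]) (auto simp: seq_continuous_def)
  have "ereal \<alpha> * R l \<le> ereal \<alpha> * liminf (\<lambda>n. R (u n))"
    using R lim \<alpha> by (intro ereal_mult_left_mono) (auto simp: seq_lsc_def)
  then have b: "ereal \<alpha> * R l \<le> liminf ?b"
    using \<alpha> by (simp add: Liminf_ereal_mult_left)
  \<comment> \<open>Nonnegativity rules out a sum of opposite infinities, so that the limit inferior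
    is superadditive.\<close>
  have "0 \<le> liminf ?a" by (intro Liminf_bounded always_eventually) simp
  moreover have "0 \<le> liminf ?b"
    using \<alpha> nonneg by (intro Liminf_bounded always_eventually) simp
  ultimately have "liminf ?a + liminf ?b \<le> liminf (\<lambda>n. ?a n + ?b n)"
    by (intro ereal_liminf_add_mono) auto
  then show "tikhonov K R g p \<alpha> l \<le> liminf (\<lambda>n. tikhonov K R g p \<alpha> (u n))"
    unfolding tikhonov_def using add_mono[OF a b] by (rule order_trans[rotated])
qed

section \<open>The direct method\<close>

text \<open>\<open>J\<close> is not assumed bounded below: the argument covers an infimum of minus
  infinity, which is then attained. If the infimum is plus infinity, every point is a
  minimizer.\<close>

lemma coercive_seq_lsc_attains_inf:
  fixes \<phi> :: "'x::banach \<Rightarrow> ('p::banach \<Rightarrow>\<^sub>L real)" and J :: "'x \<Rightarrow> ereal"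
  assumes \<phi>: "predual \<phi>"
    and sep: "separable_space (euclidean :: 'p topology) \<or> reflexive TYPE('p)"
    and coercive: "(J \<longlongrightarrow> \<infinity>) at_infinity"
    and lsc: "seq_lsc (weak_star_topology \<phi>) J"
  shows "\<exists>u. \<forall>v. J u \<le> J v"
proof -
  define m where "m = (INF v. J v)"
  have m_le: "m \<le> J v" for v unfolding m_def by (rule INF_lower) simp
  show ?thesis
  proof (cases "m = \<infinity>")
    case True
    then have "J v = \<infinity>" for v using m_le[of v] by simp
    then show ?thesis by auto
  next
    case False
    obtain s where s: "\<And>n. s n \<in> range J" "s \<longlonglongrightarrow> m"
      using Inf_as_limit[of "range J"] unfolding m_def by auto
    then have "\<forall>n. \<exists>v. s n = J v" by (simp add: image_iff)
    then obtain u0 where "s = (\<lambda>n. J (u0 n))" by metis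
    then have u0: "(\<lambda>n. J (u0 n)) \<longlonglongrightarrow> m" using s(2) by simp
    \<comment> \<open>A real level above the infimum: the minimizing sequence eventually lies below
      it, while coercivity puts \<open>J\<close> above it outside a ball.\<close>
    obtain c where c: "m < ereal c" using False ereal_dense2[of m \<infinity>] by auto
    obtain N where N: "\<And>n. n \<ge> N \<Longrightarrow> J (u0 n) < ereal c"
      using order_tendstoD(2)[OF u0 c] by (auto simp: eventually_sequentially)
    \<comment> \<open>Dropping the first \<open>N\<close> terms makes the norm bound hold for every
      index.\<close>
    define u where "u n = u0 (n + N)" for n
    have u: "(\<lambda>n. J (u n)) \<longlonglongrightarrow> m" unfolding u_def using u0 by (rule LIMSEQ_ignore_initial_segment)
    have "\<forall>\<^sub>F x in at_infinity. ereal c < J x" using coercive by (rule order_tendstoD) simp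
    then obtain b where b: "\<And>x. norm x \<ge> b \<Longrightarrow> ereal c < J x" by (auto simp: eventually_at_infinity)
    have "norm (u n) \<le> b" for n
      using b[of "u n"] N[of "n + N"] unfolding u_def by (meson le_add2 less_asym linear)
    then obtain r :: "nat \<Rightarrow> nat" and l where r: "strict_mono r"
      and l: "limitin (weak_star_topology \<phi>) (u \<circ> r) l sequentially"
      by (rule predual_bounded_seq_convergent_subseq[OF \<phi> sep])
    have "J l \<le> liminf (\<lambda>n. J ((u \<circ> r) n))"
      using lsc l unfolding seq_lsc_def by blast
    also have "\<dots> = m"
      using LIMSEQ_subseq_LIMSEQ[OF u r] by (intro lim_imp_Liminf) (auto simp: o_def)
    finally show ?thesis using m_le order_trans by blast
  qed
qed

theorem theorem4p10:
  fixes \<phi> :: "'x::banach \<Rightarrow> ('px::banach \<Rightarrow>\<^sub>L real)"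
    and \<psi> :: "'y::banach \<Rightarrow> ('py::banach \<Rightarrow>\<^sub>L real)"
    and K :: "'x \<Rightarrow> 'y" and R :: "'x \<Rightarrow> ereal" and g :: 'y and p :: real
  assumes "predual \<phi>" and "predual \<psi>"
    and "separable_space (euclidean :: 'px topology) \<or> reflexive TYPE('px)"
    and "bounded_dilinear K"
    and "\<forall>u. 0 \<le> R u" and "proper R" and "diconvex R"
    and "1 \<le> p"
    and "\<forall>\<alpha>>0. (tikhonov K R g p \<alpha> \<longlongrightarrow> \<infinity>) at_infinity"
    and "seq_lsc (weak_star_topology \<phi>) R"
    and "seq_continuous (weak_star_topology \<phi>) (weak_star_topology \<psi>) K"
  shows "\<forall>\<alpha>>0. \<exists>u. \<forall>v. tikhonov K R g p \<alpha> u \<le> tikhonov K R g p \<alpha> v"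
proof (intro allI impI)
  fix \<alpha> :: real assume "0 < \<alpha>"
  then show "\<exists>u. \<forall>v. tikhonov K R g p \<alpha> u \<le> tikhonov K R g p \<alpha> v"
    using assms
    by (intro coercive_seq_lsc_attains_inf[of \<phi>] seq_lsc_tikhonov[of \<psi>]) auto
qed

end
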